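(* Let $\mathcal{A}:\mathbb{R}^n\rightrightarrows\mathbb{R}^n$ be a maximally monotone operator, let $\gamma>0$, and let $(x_k)$ be the sequence generated by the Proximal Point Algorithm: $x_0\in\mathbb{R}^n$ and $x_{k+1}=J_{\gamma\mathcal{A}}(x_k)$ for $k=0,1,\ldots$. If the solution set $S:=\mathcal{A}^{-1}(0)=\{x : 0\in\mathcal{A}(x)\}$ is nonempty, then $\mathbf{d}(x_k,S)\to0$ as $k\to\infty$. Moreover, the sequence $(x_k)$ converges to some $\bar x\in S$.
   Context: $J_{\gamma\mathcal{A}}:=(\gamma\mathcal{A}+I)^{-1}$ is the resolvent of $\gamma\mathcal{A}$, where $I$ is the identity operator on $\mathbb{R}^n$. $\mathbf{d}(x,\Omega)=\inf_{y\in\Omega}\|x-y\|$. *)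

theory Defs
  imports "HOL-Analysis.Analysis"
begin

text \<open>
  A set-valued operator on \<open>'a\<close> is a function \<open>'a \<Rightarrow> 'a set\<close>; the empty set is allowed as a value,
  so the domain of the operator need not be the whole space.
\<close>

definition monotone_op :: "('a::real_inner \<Rightarrow> 'a set) \<Rightarrow> bool" where
  "monotone_op A \<longleftrightarrow>
     (\<forall>x y. \<forall>u \<in> A x. \<forall>v \<in> A y. (u - v) \<bullet> (x - y) \<ge> 0)"

text \<open>The order on functions into sets is pointwise inclusion, so \<open>A \<le> B\<close> is inclusion of graphs.\<close>

definition maximally_monotone_op :: "('a::real_inner \<Rightarrow> 'a set) \<Rightarrow> bool" where
  "maximally_monotone_op A \<longleftrightarrow>
     monotone_op A \<and> (\<forall>B. monotone_op B \<and> A \<le> B \<longrightarrow> B = A)"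

definition inverse_op :: "('a \<Rightarrow> 'b set) \<Rightarrow> 'b \<Rightarrow> 'a set" where
  "inverse_op A y = {x. y \<in> A x}"

definition scale_op :: "real \<Rightarrow> ('a \<Rightarrow> 'b::real_vector set) \<Rightarrow> 'a \<Rightarrow> 'b set" where
  "scale_op c A x = {c *\<^sub>R u | u. u \<in> A x}"

definition add_op :: "('a \<Rightarrow> 'b::plus set) \<Rightarrow> ('a \<Rightarrow> 'b set) \<Rightarrow> 'a \<Rightarrow> 'b set" where
  "add_op A B x = {u + v | u v. u \<in> A x \<and> v \<in> B x}"

definition id_op :: "'a \<Rightarrow> 'a set" where
  "id_op x = {x}"

definition resolvent_op :: "('a::real_vector \<Rightarrow> 'a set) \<Rightarrow> 'a \<Rightarrow> 'a set" where
  "resolvent_op A = inverse_op (add_op A id_op)"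

text \<open>
  For maximally monotone \<open>A\<close> and \<open>\<gamma> > 0\<close>, the resolvent of \<open>\<gamma>A\<close> is single-valued with full domain
  (Minty), and is then identified with the point map \<open>resolvent_map \<gamma> A\<close>.
\<close>

definition resolvent_map :: "real \<Rightarrow> ('a::real_vector \<Rightarrow> 'a set) \<Rightarrow> 'a \<Rightarrow> 'a" where
  "resolvent_map \<gamma> A x = the_elem (resolvent_op (scale_op \<gamma> A) x)"

end

theory Submission
  imports Defs
begin

text \<open>
  The theorem rests on two facts.

  Resolvents exist (Minty). Solving \<open>z \<in> x + \<gamma> A x\<close> for \<open>x\<close> means, by maximality, finding \<open>x\<close>
  with \<open>((z - x) / \<gamma> - v) \<bullet> (x - y) \<ge> 0\<close> for all \<open>v \<in> A y\<close>. For a single pair \<open>(y, v)\<close> these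
  \<open>x\<close> fill the closed ball with diameter from \<open>y\<close> to \<open>z - \<gamma> v\<close>, so by compactness it is enough that
  finitely many of these balls have a common point. Such a point is found by minimising the largest
  of the functions \<open>x \<mapsto> (x - p) \<bullet> (x - q)\<close>, one for each diameter \<open>(p, q)\<close>
  (\<open>minimax_point_with_multipliers\<close>): a minimiser is a convex combination of the centres of the
  active balls, and averaging the monotonicity inequalities with the weights of this combination
  shows that the minimal value is not positive (\<open>balls_on_antimonotone_diameters_meet\<close>).
  Uniqueness of the solution is immediate from monotonicity.

  The iterates settle down (Fejer monotonicity). For every zero \<open>s\<close> of \<open>A\<close>, monotonicity gives
  \<open>\<parallel>x\<^sub>k\<^sub>+\<^sub>1 - s\<parallel>\<^sup>2 + \<parallel>x\<^sub>k\<^sub>+\<^sub>1 - x\<^sub>k\<parallel>\<^sup>2 \<le> \<parallel>x\<^sub>k - s\<parallel>\<^sup>2\<close>. Hence the sequence is bounded and its steps tend to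
  \<open>0\<close>; since \<open>(x\<^sub>k - x\<^sub>k\<^sub>+\<^sub>1) / \<gamma> \<in> A x\<^sub>k\<^sub>+\<^sub>1\<close> and the graph of \<open>A\<close> is closed, every cluster point is a
  zero of \<open>A\<close>. The distance to that particular zero decreases along the whole sequence and tends to \<open>0\<close>
  along a subsequence, so it tends to \<open>0\<close>.
\<close>

section \<open>Balls on antimonotone diameters\<close>

lemma continuous_on_Max_image:
  fixes f :: "'i \<Rightarrow> 'a::topological_space \<Rightarrow> real"
  assumes "finite I" "I \<noteq> {}" "\<And>i. i \<in> I \<Longrightarrow> continuous_on X (f i)"
  shows "continuous_on X (\<lambda>x. Max ((\<lambda>i. f i x) ` I))"
  using assms
proof (induction I rule: finite_ne_induct)
  case (singleton i)
  then show ?case by simp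
next
  case (insert i I)
  have "continuous_on X (\<lambda>x. max (f i x) (Max ((\<lambda>i. f i x) ` I)))"
    using insert by (intro continuous_on_max) auto
  then show ?case using insert by simp
qed

text \<open>
  This is the first-order condition \<open>0 \<in> conv {\<nabla>f\<^sub>t(x) | t active}\<close> at a minimiser \<open>x\<close> of the maximum of
  the functions \<open>f\<^sub>t(x) = (x - p) \<bullet> (x - q)\<close>, \<open>t = (p, q)\<close>, whose gradients are
  \<open>2x - (p + q)\<close>: if \<open>x\<close> were outside the convex hull of the active centres \<open>(p + q) / 2\<close>, a small
  step towards the closest point of that hull would decrease all active functions at once. The third property of the
  multipliers is complementary slackness: only active functions carry weight.
\<close>

lemma minimax_point_with_multipliers:
  fixes T :: "('a::euclidean_space \<times> 'a) set"
  assumes T: "finite T" "T \<noteq> {}"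
  obtains x \<mu> u where
    "\<And>t. t \<in> T \<Longrightarrow> (x - fst t) \<bullet> (x - snd t) \<le> \<mu>"
    "\<And>t. t \<in> T \<Longrightarrow> u t \<ge> (0::real)"
    "\<And>t. t \<in> T \<Longrightarrow> u t * ((x - fst t) \<bullet> (x - snd t)) = u t * \<mu>"
    "(\<Sum>t\<in>T. u t) = 1"
    "(\<Sum>t\<in>T. u t *\<^sub>R (fst t + snd t)) = 2 *\<^sub>R x"
proof -
  define f where "f t x = (x - fst t) \<bullet> (x - snd t)" for t and x :: 'a
  define c where "c t = (1/2) *\<^sub>R (fst t + snd t)" for t :: "'a \<times> 'a"
  define F where "F x = Max ((\<lambda>t. f t x) ` T)" for x
  \<comment> \<open>Minimising over the hull of all centres gives compactness, and the descent step
    below stays inside it.\<close>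
  define K where "K = convex hull (c ` T)"
  have lin_c: "linear c"
    unfolding c_def by (intro linearI) (auto simp: algebra_simps)
  have "continuous_on K F"
    unfolding F_def using T by (intro continuous_on_Max_image) (auto simp: f_def intro!: continuous_intros)
  moreover have "compact K" "K \<noteq> {}"
    unfolding K_def using T by (auto intro: finite_imp_compact_convex_hull)
  ultimately obtain x where x: "x \<in> K" and min: "\<And>y. y \<in> K \<Longrightarrow> F x \<le> F y"
    using continuous_attains_inf by metis
  define \<mu> where "\<mu> = F x"
  have le: "f t x \<le> \<mu>" if "t \<in> T" for t
    using that T by (simp add: \<mu>_def F_def)
  define T0 where "T0 = {t \<in> T. f t x = \<mu>}"
  have "\<mu> \<in> (\<lambda>t. f t x) ` T"
    unfolding \<mu>_def F_def using T by (intro Max_in) auto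
  then have T0: "finite T0" "T0 \<noteq> {}" "T0 \<subseteq> T"
    unfolding T0_def using T by auto
  define H where "H = convex hull (c ` T0)"
  have "x \<in> H"
  proof (rule ccontr)
    assume "x \<notin> H"
    define m where "m = closest_point H x"
    define d where "d = m - x"
    have H: "compact H" "convex H" "H \<noteq> {}" "closed H"
      unfolding H_def using T0 by (auto intro: finite_imp_compact_convex_hull compact_imp_closed)
    have "m \<in> H"
      unfolding m_def using H by (intro closest_point_in_set) auto
    then have "d \<noteq> 0" using \<open>x \<notin> H\<close> by (auto simp: d_def)
    have "H \<subseteq> K"
      unfolding H_def K_def using T0 by (intro hull_mono) auto
    have expand: "f t (x + s *\<^sub>R d) = f t x - 2 * s * (d \<bullet> (c t - x)) + s * s * (d \<bullet> d)" for t s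
      by (simp add: f_def c_def algebra_simps inner_commute)
    have toward: "d \<bullet> d \<le> d \<bullet> (c t - x)" if "t \<in> T0" for t
    proof -
      have "(x - m) \<bullet> (c t - m) \<le> 0"
        unfolding m_def using H that by (intro closest_point_dot) (auto simp: H_def intro: hull_inc)
      then show ?thesis by (simp add: d_def algebra_simps inner_commute)
    qed
    have "\<forall>\<^sub>F s in at_right 0. f t (x + s *\<^sub>R d) < \<mu>" if "t \<in> T" for t
    proof (cases "t \<in> T0")
      case True
      have "\<forall>\<^sub>F s in at_right 0. (s::real) \<in> {0<..<1}"
        by (rule eventually_at_right_real) simp
      then show ?thesis
      proof eventually_elim
        case (elim s)
        have "f t (x + s *\<^sub>R d) \<le> \<mu> - 2 * s * (d \<bullet> d) + s * s * (d \<bullet> d)"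
          using elim toward[OF True] True unfolding expand by (simp add: T0_def)
        also have "\<dots> = \<mu> - s * (2 - s) * (d \<bullet> d)" by (simp add: algebra_simps)
        also have "\<dots> < \<mu>" using elim \<open>d \<noteq> 0\<close> by simp
        finally show ?case .
      qed
    next
      case False
      have "((\<lambda>s. f t (x + s *\<^sub>R d)) \<longlongrightarrow> f t (x + 0 *\<^sub>R d)) (at_right 0)"
        unfolding f_def by (intro tendsto_intros)
      moreover have "f t (x + 0 *\<^sub>R d) < \<mu>"
        using False that le[OF that] by (simp add: T0_def)
      ultimately show ?thesis by (rule order_tendstoD)
    qed
    then have "\<forall>\<^sub>F s in at_right 0. \<forall>t\<in>T. f t (x + s *\<^sub>R d) < \<mu>"
      using T by (simp add: eventually_ball_finite)
    moreover have "\<forall>\<^sub>F s in at_right 0. (s::real) \<in> {0<..<1}"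
      by (rule eventually_at_right_real) simp
    ultimately have "\<forall>\<^sub>F s in at_right 0. (\<forall>t\<in>T. f t (x + s *\<^sub>R d) < \<mu>) \<and> (s::real) \<in> {0<..<1}"
      by (rule eventually_conj)
    then obtain s :: real where s: "\<forall>t\<in>T. f t (x + s *\<^sub>R d) < \<mu>" "0 < s" "s < 1"
      using eventually_happens[OF _] by force
    have "x + s *\<^sub>R d = (1 - s) *\<^sub>R x + s *\<^sub>R m" by (simp add: d_def algebra_simps)
    also have "\<dots> \<in> K"
      using s x \<open>m \<in> H\<close> \<open>H \<subseteq> K\<close> by (intro convexD) (auto simp: K_def)
    finally have "\<mu> \<le> F (x + s *\<^sub>R d)" using min by (simp add: \<mu>_def)
    moreover have "F (x + s *\<^sub>R d) < \<mu>" unfolding F_def using s T by simp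
    ultimately show False by simp
  qed
  \<comment> \<open>The weights are taken in the product space, where the pairs live, because different pairs may
    share a centre.\<close>
  then obtain w where w: "w \<in> convex hull T0" "x = c w"
    unfolding H_def convex_hull_linear_image[OF lin_c, symmetric] by blast
  then obtain v where v: "\<forall>t\<in>T0. 0 \<le> v t" "sum v T0 = 1" "(\<Sum>t\<in>T0. v t *\<^sub>R t) = w"
    using T0 by (auto simp: convex_hull_finite)
  define u where "u t = (if t \<in> T0 then v t else 0)" for t
  have "(\<Sum>t\<in>T. u t *\<^sub>R (fst t + snd t)) = (\<Sum>t\<in>T0. v t *\<^sub>R (fst t + snd t))"
    using T T0 by (intro sum.mono_neutral_cong_right) (auto simp: u_def)
  also have "\<dots> = fst w + snd w"
    unfolding v(3)[symmetric] by (simp add: fst_sum snd_sum sum.distrib scaleR_add_right)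
  also have "\<dots> = 2 *\<^sub>R x" by (simp add: w c_def)
  finally have bary: "(\<Sum>t\<in>T. u t *\<^sub>R (fst t + snd t)) = 2 *\<^sub>R x" .
  have "(\<Sum>t\<in>T. u t) = (\<Sum>t\<in>T0. v t)"
    using T T0 by (intro sum.mono_neutral_cong_right) (auto simp: u_def)
  then have total: "(\<Sum>t\<in>T. u t) = 1" using v(2) by simp
  have active: "u t * f t x = u t * \<mu>" for t
    by (simp add: u_def T0_def)
  have nonneg: "u t \<ge> 0" for t
    using v(1) by (simp add: u_def)
  show thesis
    by (rule that[OF le[unfolded f_def] nonneg active[unfolded f_def] total bary])
qed

text \<open>
  \<open>(x - p) \<bullet> (x - q) \<le> 0\<close> says that \<open>x\<close> lies in the closed ball with diameter from \<open>p\<close> to \<open>q\<close>.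
  In the double sum of the hypotheses, weighted by the multipliers of a minimax point, everything is
  determined by the weighted means of \<open>p\<close> and \<open>q\<close>; these add up to \<open>2x\<close>, which leaves a negative square.
\<close>

lemma balls_on_antimonotone_diameters_meet:
  fixes T :: "('a::euclidean_space \<times> 'a) set"
  assumes fin: "finite T"
    and anti: "\<And>p q p' q'. (p, q) \<in> T \<Longrightarrow> (p', q') \<in> T \<Longrightarrow> (p - p') \<bullet> (q - q') \<le> 0"
  shows "\<exists>x. \<forall>(p, q)\<in>T. (x - p) \<bullet> (x - q) \<le> 0"
proof (cases "T = {}")
  case False
  obtain x \<mu> u where
    le: "\<And>t. t \<in> T \<Longrightarrow> (x - fst t) \<bullet> (x - snd t) \<le> \<mu>" and
    u0: "\<And>t. t \<in> T \<Longrightarrow> u t \<ge> (0::real)" and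
    act: "\<And>t. t \<in> T \<Longrightarrow> u t * ((x - fst t) \<bullet> (x - snd t)) = u t * \<mu>" and
    u1: "(\<Sum>t\<in>T. u t) = 1" and
    bary: "(\<Sum>t\<in>T. u t *\<^sub>R (fst t + snd t)) = 2 *\<^sub>R x"
    by (rule minimax_point_with_multipliers[OF fin False]) blast
  define P where "P = (\<Sum>t\<in>T. u t *\<^sub>R fst t)"
  define Q where "Q = (\<Sum>t\<in>T. u t *\<^sub>R snd t)"
  define R where "R = (\<Sum>t\<in>T. u t * (fst t \<bullet> snd t))"
  have PQ: "P + Q = 2 *\<^sub>R x"
    using bary by (simp add: P_def Q_def scaleR_add_right sum.distrib)
  have "\<mu> = (\<Sum>t\<in>T. u t * \<mu>)" by (simp add: u1 flip: sum_distrib_right)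
  also have "\<dots> = (\<Sum>t\<in>T. u t * ((x - fst t) \<bullet> (x - snd t)))"
    by (intro sum.cong refl act[symmetric])
  also have "\<dots> = (\<Sum>t\<in>T. u t * (fst t \<bullet> snd t) - x \<bullet> (u t *\<^sub>R (fst t + snd t)) + u t * (x \<bullet> x))"
    by (intro sum.cong) (auto simp: algebra_simps inner_commute)
  also have "\<dots> = R - x \<bullet> (2 *\<^sub>R x) + x \<bullet> x"
    by (simp only: sum.distrib sum_subtractf inner_sum_right[symmetric] sum_distrib_right[symmetric]
        R_def[symmetric] bary u1 mult_1)
  finally have \<mu>: "\<mu> = R - x \<bullet> x" by simp
  have row: "(\<Sum>t'\<in>T. u t' * ((fst t - fst t') \<bullet> (snd t - snd t'))) =
      fst t \<bullet> snd t - fst t \<bullet> Q - P \<bullet> snd t + R" for t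
  proof -
    have "(\<Sum>t'\<in>T. u t' * ((fst t - fst t') \<bullet> (snd t - snd t'))) =
      (\<Sum>t'\<in>T. u t' * (fst t \<bullet> snd t) - fst t \<bullet> (u t' *\<^sub>R snd t') - (u t' *\<^sub>R fst t') \<bullet> snd t
          + u t' * (fst t' \<bullet> snd t'))"
      by (intro sum.cong) (auto simp: algebra_simps)
    also have "\<dots> = (\<Sum>t'\<in>T. u t') * (fst t \<bullet> snd t) - fst t \<bullet> Q - P \<bullet> snd t + R"
      unfolding P_def Q_def R_def inner_sum_right inner_sum_left sum_distrib_right
      by (simp only: sum.distrib sum_subtractf)
    finally show ?thesis by (simp add: u1)
  qed
  have "(\<Sum>t\<in>T. u t * (\<Sum>t'\<in>T. u t' * ((fst t - fst t') \<bullet> (snd t - snd t')))) \<le> 0"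
    using u0 anti by (intro sum_nonpos mult_nonneg_nonpos) auto
  also have "(\<Sum>t\<in>T. u t * (\<Sum>t'\<in>T. u t' * ((fst t - fst t') \<bullet> (snd t - snd t')))) =
      (\<Sum>t\<in>T. u t * (fst t \<bullet> snd t) - (u t *\<^sub>R fst t) \<bullet> Q - P \<bullet> (u t *\<^sub>R snd t) + u t * R)"
    unfolding row by (intro sum.cong) (auto simp: algebra_simps)
  also have "\<dots> = R - P \<bullet> Q - P \<bullet> Q + (\<Sum>t\<in>T. u t) * R"
    by (simp only: sum.distrib sum_subtractf inner_sum_right[symmetric] inner_sum_left[symmetric]
        sum_distrib_right R_def[symmetric] P_def[symmetric] Q_def[symmetric])
  finally have "R \<le> P \<bullet> Q" by (simp add: u1)
  moreover have "P \<bullet> Q = x \<bullet> x - (P - x) \<bullet> (P - x)"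
  proof -
    have Q: "Q = 2 *\<^sub>R x - P" using PQ by (simp add: algebra_simps)
    show ?thesis unfolding Q by (simp add: algebra_simps inner_commute)
  qed
  ultimately have "\<mu> \<le> 0" using \<mu> inner_ge_zero[of "P - x"] by linarith
  then have "\<forall>t\<in>T. (x - fst t) \<bullet> (x - snd t) \<le> 0" using le order_trans by blast
  then show ?thesis by (intro exI[of _ x]) (simp add: case_prod_beta)
qed auto

section \<open>Resolvents of maximally monotone operators\<close>

lemma monotone_opD:
  "monotone_op A \<Longrightarrow> u \<in> A x \<Longrightarrow> v \<in> A y \<Longrightarrow> (u - v) \<bullet> (x - y) \<ge> 0"
  by (auto simp: monotone_op_def)

text \<open>Adding a monotonically related pair to the graph keeps it monotone, so the pair was there already.\<close>

lemma maximally_monotone_op_memI: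
  assumes A: "maximally_monotone_op A"
    and rel: "\<And>y v. v \<in> A y \<Longrightarrow> (u - v) \<bullet> (x - y) \<ge> 0"
  shows "u \<in> A x"
proof -
  define B where "B = A(x := insert u (A x))"
  have rel': "(v - u) \<bullet> (y - x) \<ge> 0" if "v \<in> A y" for y v
    using rel[OF that] by (simp add: algebra_simps)
  have "monotone_op A" using A by (simp add: maximally_monotone_op_def)
  then have "monotone_op B"
    unfolding monotone_op_def B_def using rel rel' by (auto split: if_splits)
  moreover have "A \<le> B" by (auto simp: B_def le_fun_def)
  ultimately have "B = A" using A by (auto simp: maximally_monotone_op_def)
  then show ?thesis unfolding B_def by (metis fun_upd_same insertI1)
qed

text \<open>
  The surjectivity half of Minty's theorem. The diameters are \<open>(y, z - \<gamma> v)\<close> with \<open>v \<in> A y\<close>; the sign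
  in the second component turns monotonicity of \<open>A\<close> into the antimonotonicity of the diameters.
\<close>

lemma Minty_surjective:
  fixes A :: "'a::euclidean_space \<Rightarrow> 'a set"
  assumes A: "maximally_monotone_op A" and \<gamma>: "\<gamma> > 0"
  shows "\<exists>x. (1 / \<gamma>) *\<^sub>R (z - x) \<in> A x"
proof -
  define G where "G = {(y, z - \<gamma> *\<^sub>R v) | y v. v \<in> A y}"
  define C where "C t = {x. (x - fst t) \<bullet> (x - snd t) \<le> 0}" for t :: "'a \<times> 'a"
  have mono: "monotone_op A" using A by (simp add: maximally_monotone_op_def)
  have anti: "(p - p') \<bullet> (q - q') \<le> 0" if G: "(p, q) \<in> G" "(p', q') \<in> G" for p q p' q'
  proof -
    obtain v v' where v: "q = z - \<gamma> *\<^sub>R v" "v \<in> A p" "q' = z - \<gamma> *\<^sub>R v'" "v' \<in> A p'"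
      using G by (auto simp: G_def)
    have "(p - p') \<bullet> (q - q') = - (\<gamma> * ((v - v') \<bullet> (p - p')))"
      by (simp add: v algebra_simps inner_commute)
    then show ?thesis using monotone_opD[OF mono v(2,4)] \<gamma> by simp
  qed
  have ball: "C t = cball ((1/2) *\<^sub>R (fst t + snd t)) (norm (fst t - snd t) / 2)" for t
  proof -
    have "x \<in> C t \<longleftrightarrow> x \<in> cball ((1/2) *\<^sub>R (fst t + snd t)) (norm (fst t - snd t) / 2)" for x
    proof -
      have "(x - fst t) \<bullet> (x - snd t) \<le> 0 \<longleftrightarrow>
          (norm ((1/2) *\<^sub>R (fst t + snd t) - x))\<^sup>2 \<le> (norm (fst t - snd t) / 2)\<^sup>2"
        unfolding power_divide power2_norm_eq_inner
        by (simp add: algebra_simps inner_commute) linarith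
      also have "\<dots> \<longleftrightarrow> norm ((1/2) *\<^sub>R (fst t + snd t) - x) \<le> norm (fst t - snd t) / 2"
        by (rule power_mono_iff) simp_all
      finally show ?thesis by (simp only: C_def mem_Collect_eq mem_cball dist_norm)
    qed
    then show ?thesis by blast
  qed
  have "\<Inter> (C ` G) \<noteq> {}"
  proof (rule compact_fip_Heine_Borel)
    fix F assume F: "finite F" "F \<subseteq> C ` G"
    then obtain T where T: "finite T" "T \<subseteq> G" "F = C ` T"
      by (meson finite_subset_image)
    obtain x where "\<forall>(p, q)\<in>T. (x - p) \<bullet> (x - q) \<le> 0"
      using balls_on_antimonotone_diameters_meet[OF T(1)] anti T(2) by blast
    then have "x \<in> \<Inter> F" by (auto simp: T C_def)
    then show "\<Inter> F \<noteq> {}" by blast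
  qed (auto simp: ball)
  then obtain x where x: "\<And>t. t \<in> G \<Longrightarrow> x \<in> C t" by blast
  have "(1 / \<gamma>) *\<^sub>R (z - x) \<in> A x"
  proof (rule maximally_monotone_op_memI[OF A])
    fix y v assume "v \<in> A y"
    then have "x \<in> C (y, z - \<gamma> *\<^sub>R v)" by (intro x) (auto simp: G_def)
    then have "0 \<le> (z - \<gamma> *\<^sub>R v - x) \<bullet> (x - y)" by (simp add: C_def algebra_simps inner_commute)
    also have "z - \<gamma> *\<^sub>R v - x = \<gamma> *\<^sub>R ((1 / \<gamma>) *\<^sub>R (z - x) - v)"
      using \<gamma> by (simp add: algebra_simps)
    finally show "0 \<le> ((1 / \<gamma>) *\<^sub>R (z - x) - v) \<bullet> (x - y)"
      using \<gamma> by (simp add: zero_le_mult_iff)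
  qed
  then show ?thesis ..
qed

lemma mem_resolvent_op_scale_iff:
  assumes "\<gamma> > 0"
  shows "x \<in> resolvent_op (scale_op \<gamma> A) z \<longleftrightarrow> (1 / \<gamma>) *\<^sub>R (z - x) \<in> A x"
proof -
  have "x \<in> resolvent_op (scale_op \<gamma> A) z \<longleftrightarrow> (\<exists>u \<in> A x. z = \<gamma> *\<^sub>R u + x)"
    by (auto simp: resolvent_op_def inverse_op_def add_op_def scale_op_def id_op_def)
  also have "\<dots> \<longleftrightarrow> (\<exists>u \<in> A x. u = (1 / \<gamma>) *\<^sub>R (z - x))"
  proof (intro bex_cong refl)
    fix u
    have "z = \<gamma> *\<^sub>R u + x \<longleftrightarrow> \<gamma> *\<^sub>R u = z - x" by (auto simp: algebra_simps)
    also have "\<dots> \<longleftrightarrow> u = (1 / \<gamma>) *\<^sub>R (z - x)"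
      using assms by (auto dest: arg_cong[where f = "\<lambda>w. (1 / \<gamma>) *\<^sub>R w"])
    finally show "z = \<gamma> *\<^sub>R u + x \<longleftrightarrow> u = (1 / \<gamma>) *\<^sub>R (z - x)" .
  qed
  finally show ?thesis by simp
qed

lemma resolvent_map_inclusion:
  fixes A :: "'a::euclidean_space \<Rightarrow> 'a set"
  assumes A: "maximally_monotone_op A" and \<gamma>: "\<gamma> > 0"
  shows "(1 / \<gamma>) *\<^sub>R (z - resolvent_map \<gamma> A z) \<in> A (resolvent_map \<gamma> A z)"
proof -
  obtain x where x: "(1 / \<gamma>) *\<^sub>R (z - x) \<in> A x"
    using Minty_surjective[OF A \<gamma>] by blast
  have "y = x" if y: "(1 / \<gamma>) *\<^sub>R (z - y) \<in> A y" for y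
  proof -
    have "0 \<le> ((1 / \<gamma>) *\<^sub>R (z - y) - (1 / \<gamma>) *\<^sub>R (z - x)) \<bullet> (y - x)"
      using A y x by (intro monotone_opD) (auto simp: maximally_monotone_op_def)
    also have "(1 / \<gamma>) *\<^sub>R (z - y) - (1 / \<gamma>) *\<^sub>R (z - x) = - ((1 / \<gamma>) *\<^sub>R (y - x))"
      by (simp add: algebra_simps)
    finally have "(y - x) \<bullet> (y - x) \<le> 0"
      using \<gamma> by (simp add: divide_le_0_iff)
    then show ?thesis by (metis inner_eq_zero_iff inner_ge_zero order_antisym right_minus_eq)
  qed
  then have "resolvent_op (scale_op \<gamma> A) z = {x}"
    unfolding set_eq_iff mem_resolvent_op_scale_iff[OF \<gamma>] singleton_iff using x by metis
  then show ?thesis using x by (simp add: resolvent_map_def)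
qed

section \<open>Convergence of the proximal point iteration\<close>

lemma maximally_monotone_op_closed_graph:
  assumes A: "maximally_monotone_op A"
    and graph: "\<And>k. u k \<in> A (y k)"
    and lim: "u \<longlonglongrightarrow> u0" "y \<longlonglongrightarrow> y0"
  shows "u0 \<in> A y0"
proof (rule maximally_monotone_op_memI[OF A])
  fix z v assume v: "v \<in> A z"
  have "(\<lambda>k. (u k - v) \<bullet> (y k - z)) \<longlonglongrightarrow> (u0 - v) \<bullet> (y0 - z)"
    by (intro tendsto_inner tendsto_diff tendsto_const lim)
  then show "0 \<le> (u0 - v) \<bullet> (y0 - z)"
  proof (rule LIMSEQ_le_const, intro exI allI impI)
    show "0 \<le> (u k - v) \<bullet> (y k - z)" for k
      using A graph v by (intro monotone_opD) (auto simp: maximally_monotone_op_def)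
  qed
qed

text \<open>
  Monotonicity between \<open>y\<close> and the zero \<open>s\<close> says that the step \<open>x - y\<close> makes no obtuse angle with
  \<open>y - s\<close>; the law of cosines turns this into the stated inequality.
\<close>

lemma resolvent_step_Fejer:
  fixes s :: "'a::real_inner"
  assumes mono: "monotone_op A" and \<gamma>: "\<gamma> > 0"
    and s: "0 \<in> A s" and y: "(1 / \<gamma>) *\<^sub>R (x - y) \<in> A y"
  shows "(norm (y - s))\<^sup>2 + (norm (y - x))\<^sup>2 \<le> (norm (x - s))\<^sup>2"
proof -
  have "0 \<le> ((1 / \<gamma>) *\<^sub>R (x - y) - 0) \<bullet> (y - s)"
    using mono y s by (rule monotone_opD)
  then have "0 \<le> (x - y) \<bullet> (y - s)"
    using \<gamma> by (simp add: zero_le_divide_iff)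
  then show ?thesis
    by (simp add: power2_norm_eq_inner algebra_simps inner_commute)
qed

theorem theorem13:
  fixes A :: "real ^ 'n \<Rightarrow> (real ^ 'n) set"
    and \<gamma> :: real
    and x :: "nat \<Rightarrow> real ^ 'n"
    and S :: "(real ^ 'n) set"
  assumes "maximally_monotone_op A"
    and "\<gamma> > 0"
    and "\<And>k. x (Suc k) = resolvent_map \<gamma> A (x k)"
    and "S = inverse_op A 0"
    and "S \<noteq> {}"
  shows "(\<lambda>k. infdist (x k) S) \<longlonglongrightarrow> 0 \<and> (\<exists>xbar \<in> S. x \<longlonglongrightarrow> xbar)"
proof -
  have step: "(1 / \<gamma>) *\<^sub>R (x k - x (Suc k)) \<in> A (x (Suc k))" for k
    unfolding assms(3) by (rule resolvent_map_inclusion[OF assms(1,2)])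
  have mono: "monotone_op A" using assms(1) by (simp add: maximally_monotone_op_def)
  have S: "s \<in> S \<longleftrightarrow> 0 \<in> A s" for s by (simp add: assms(4) inverse_op_def)
  have fejer: "(norm (x (Suc k) - s))\<^sup>2 + (norm (x (Suc k) - x k))\<^sup>2 \<le> (norm (x k - s))\<^sup>2"
    if "s \<in> S" for s k
    using resolvent_step_Fejer[OF mono assms(2) _ step] that S by blast
  have dec: "decseq (\<lambda>k. norm (x k - s))" if "s \<in> S" for s
  proof (rule decseq_SucI)
    fix k
    have "(norm (x (Suc k) - s))\<^sup>2 \<le> (norm (x k - s))\<^sup>2"
      using fejer[OF that, of k] zero_le_power2[of "norm (x (Suc k) - x k)"] by linarith
    then show "norm (x (Suc k) - s) \<le> norm (x k - s)" by (rule power2_le_imp_le) simp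
  qed
  have conv: "convergent (\<lambda>k. norm (x k - s))" if s: "s \<in> S" for s
  proof -
    obtain l where "(\<lambda>k. norm (x k - s)) \<longlonglongrightarrow> l"
      by (rule decseq_convergent[OF dec[OF s], of 0]) auto
    then show ?thesis by (rule convergentI)
  qed
  obtain s where s: "s \<in> S" using assms(5) by blast
  have steps0: "(\<lambda>k. x (Suc k) - x k) \<longlonglongrightarrow> 0"
  proof -
    obtain l where l: "(\<lambda>k. norm (x k - s)) \<longlonglongrightarrow> l"
      using conv[OF s] by (auto simp: convergent_def)
    have "(\<lambda>k. (norm (x k - s))\<^sup>2 - (norm (x (Suc k) - s))\<^sup>2) \<longlonglongrightarrow> l\<^sup>2 - l\<^sup>2"
      by (intro tendsto_diff tendsto_power l LIMSEQ_Suc[OF l])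
    then have gap: "(\<lambda>k. (norm (x k - s))\<^sup>2 - (norm (x (Suc k) - s))\<^sup>2) \<longlonglongrightarrow> 0" by simp
    have "(norm (x (Suc k) - x k))\<^sup>2 \<le> (norm (x k - s))\<^sup>2 - (norm (x (Suc k) - s))\<^sup>2" for k
      using fejer[OF s, of k] by linarith
    then have "(\<lambda>k. (norm (x (Suc k) - x k))\<^sup>2) \<longlonglongrightarrow> 0"
      by (intro tendsto_sandwich[OF _ _ tendsto_const gap]) auto
    then show ?thesis by (simp add: tendsto_norm_zero_iff)
  qed
  have "bounded (range x)"
  proof -
    have "norm (x k - s) \<le> norm (x 0 - s)" for k
      using decseqD[OF dec[OF s], of 0 k] by simp
    then show ?thesis by (intro bounded_subset[OF bounded_cball[of s "norm (x 0 - s)"]])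
        (auto simp: dist_norm norm_minus_commute)
  qed
  then obtain xbar r where r: "strict_mono (r::nat \<Rightarrow> nat)" "(x \<circ> r) \<longlonglongrightarrow> xbar"
    using bounded_imp_convergent_subsequence by blast
  have r0: "(\<lambda>k. x (Suc (r k)) - x (r k)) \<longlonglongrightarrow> 0"
    using LIMSEQ_subseq_LIMSEQ[OF steps0 r(1)] by (simp add: o_def)
  have "0 \<in> A xbar"
  proof (rule maximally_monotone_op_closed_graph[OF assms(1)])
    show "(1 / \<gamma>) *\<^sub>R (x (r k) - x (Suc (r k))) \<in> A (x (Suc (r k)))" for k by (rule step)
    have "(\<lambda>k. (- 1 / \<gamma>) *\<^sub>R (x (Suc (r k)) - x (r k))) \<longlonglongrightarrow> (- 1 / \<gamma>) *\<^sub>R 0"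
      by (intro tendsto_scaleR tendsto_const r0)
    then show "(\<lambda>k. (1 / \<gamma>) *\<^sub>R (x (r k) - x (Suc (r k)))) \<longlonglongrightarrow> 0"
      by (simp add: algebra_simps)
    show "(\<lambda>k. x (Suc (r k))) \<longlonglongrightarrow> xbar"
      using tendsto_add[OF r0 r(2)] by (simp add: o_def)
  qed
  then have xbar: "xbar \<in> S" using S by blast
  have "x \<longlonglongrightarrow> xbar"
  proof -
    obtain l where l: "(\<lambda>k. norm (x k - xbar)) \<longlonglongrightarrow> l"
      using conv[OF xbar] by (auto simp: convergent_def)
    have "(\<lambda>k. norm (x (r k) - xbar)) \<longlonglongrightarrow> l"
      using LIMSEQ_subseq_LIMSEQ[OF l r(1)] by (simp add: o_def)
    moreover have "(\<lambda>k. norm (x (r k) - xbar)) \<longlonglongrightarrow> norm (xbar - xbar)"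
      using r(2) by (intro tendsto_norm tendsto_diff tendsto_const) (simp add: o_def)
    ultimately have "l = 0" using LIMSEQ_unique by fastforce
    with l show ?thesis by (simp add: LIM_zero_iff tendsto_norm_zero_iff)
  qed
  moreover have "(\<lambda>k. infdist (x k) S) \<longlonglongrightarrow> infdist xbar S"
    using calculation by (rule tendsto_infdist)
  ultimately show ?thesis using xbar by auto
qed

end
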